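(* $\vec{\chi}(\mathrm{Forb}_{\mathrm{ind}}(\overset{\leftrightarrow}{K}_2,S_2^+,W_3^-)) \le 4.$
   Context: All digraphs are finite and simple: no loops, and between two vertices at most one arc in each direction (so pairs of opposite arcs are allowed in general). $(u,v)$ denotes an arc with tail $u$ and head $v$. An acyclic $k$-coloring of a digraph $D$ is a map $c:V(D)\to S$ with $|S|=k$ such that each color class $c^{-1}(i)$, $i \in S$, induces a subdigraph without directed cycles (a digon, i.e. a pair of opposite arcs $(x,y),(y,x)$, counts as a directed cycle of length two). The dichromatic number $\vec{\chi}(D)$ is the smallest $k$ for which an acyclic $k$-coloring of $D$ exists. For a set (or list) $\mathcal{F}$ of digraphs, $\mathrm{Forb}_{\mathrm{ind}}(\mathcal{F})$ is the set of digraphs containing no induced subdigraph isomorphic to a member of $\mathcal{F}$. When the digraphs in this class have bounded dichromatic number, $\vec{\chi}(\mathrm{Forb}_{\mathrm{ind}}(\mathcal{F})):=\max\{\vec{\chi}(D) \mid D\in \mathrm{Forb}_{\mathrm{ind}}(\mathcal{F})\}$; an upper bound for this quantity includes the assertion that it is well defined. $\overset{\leftrightarrow}{K}_2$ is the digon: two vertices joined by arcs in both directions. $S_k^+$ (resp. $S_k^-$) is the orientation of the star with $k$ leaves in which all arcs are directed away from (resp. towards) the center. $W_3^-$ is the digraph obtained from $S_3^-$ by connecting its three leaves by a directed cycle (directed triangle). *)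

theory Defs
  imports "Graph_Theory.Pair_Digraph" "Graph_Theory.Digraph_Isomorphism"
begin

(* The finite simple digraphs are those satisfying pair_digraph: finite, loopfree, and with
   arcs given as ordered pairs, so that there are no parallel arcs but digons are allowed. *)

section \<open>Dichromatic number\<close>

(* The library notion of a directed cycle includes the walk [(x,y), (y,x)] around a digon. *)
definition acyclic_digraph :: "('a, 'b) pre_digraph \<Rightarrow> bool" where
  "acyclic_digraph G \<longleftrightarrow> (\<nexists>p. pre_digraph.cycle G p)"

definition acyclic_coloring :: "'a pair_pre_digraph \<Rightarrow> 'c set \<Rightarrow> ('a \<Rightarrow> 'c) \<Rightarrow> bool" where
  "acyclic_coloring D S c \<longleftrightarrow>
     c ` pverts D \<subseteq> S \<and>
     (\<forall>i\<in>S. acyclic_digraph (with_proj D \<restriction> {v \<in> pverts D. c v = i}))"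

(* Colors are taken from nat, which contains a set of every finite size. *)
definition acyclic_colorable :: "nat \<Rightarrow> 'a pair_pre_digraph \<Rightarrow> bool" where
  "acyclic_colorable k D \<longleftrightarrow>
     (\<exists>(S :: nat set) c. finite S \<and> card S = k \<and> acyclic_coloring D S c)"

definition dichromatic_number :: "'a pair_pre_digraph \<Rightarrow> nat" where
  "dichromatic_number D = (LEAST k. acyclic_colorable k D)"

section \<open>Classes defined by forbidden induced subdigraphs\<close>

definition has_induced :: "'a pair_pre_digraph \<Rightarrow> 'b pair_pre_digraph \<Rightarrow> bool" where
  "has_induced D F \<longleftrightarrow>
     (\<exists>H. induced_subgraph H (with_proj D) \<and> digraph_iso H (with_proj F))"

definition Forb_ind :: "'b pair_pre_digraph set \<Rightarrow> 'a pair_pre_digraph set" where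
  "Forb_ind \<F> = {D. pair_digraph D \<and> (\<forall>F\<in>\<F>. \<not> has_induced D F)}"

(* Meaningful for a nonempty class of bounded dichromatic number only. *)
definition class_dichromatic_number :: "'a pair_pre_digraph set \<Rightarrow> nat" where
  "class_dichromatic_number \<C> = Max (dichromatic_number ` \<C>)"

section \<open>Specific digraphs\<close>

definition digon :: "nat pair_pre_digraph" where
  "digon = \<lparr> pverts = {0, 1}, parcs = {(0, 1), (1, 0)} \<rparr>"

(* Stars have center 0 and leaves 1, ..., k. *)
definition out_star :: "nat \<Rightarrow> nat pair_pre_digraph" where
  "out_star k = \<lparr> pverts = {0..k}, parcs = {(0, i) | i. i \<in> {1..k}} \<rparr>"

definition in_star :: "nat \<Rightarrow> nat pair_pre_digraph" where
  "in_star k = \<lparr> pverts = {0..k}, parcs = {(i, 0) | i. i \<in> {1..k}} \<rparr>"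

definition in_wheel3 :: "nat pair_pre_digraph" where
  "in_wheel3 =
     \<lparr> pverts = pverts (in_star 3), parcs = parcs (in_star 3) \<union> {(1, 2), (2, 3), (3, 1)} \<rparr>"

end

theory Submission
  imports Defs
begin

text \<open>
  A digraph of this class has no digons, out-neighborhoods that are tournaments, and
  in-neighborhoods without directed triangles. As every directed cycle lies in a strong component,
  it may be assumed strong. Fix a vertex \<open>v\<close>; two colors are used on its closed out-neighborhood
  and two others on the remaining vertices. The closed out-neighborhood is a tournament whose
  in-neighborhoods are acyclic (\<open>tournament_split\<close>). On the remaining vertices, an arc never
  increases the distance to \<open>v\<close>. Hence a directed triangle stays at one distance, and its vertices
  have a common out-neighbor at the next smaller distance, which gives an in-wheel; so there is no
  triangle (\<open>no_triangle_outside_closed_out_neighborhood\<close>), and out-neighborhoods are acyclic.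

  After reversing the tournament, both parts are therefore digraphs whose out-neighborhoods are
  transitive tournaments, and it remains to color such digraphs with two colors. The induction
  proves more: the closed out-neighborhood of any given vertex can be made monochromatic
  (\<open>acyclic_split_closed_out_neighborhood\<close>). The main step is a structure theorem for strong
  digraphs of this kind (\<open>round_partition\<close>): the vertex set falls into at least two parts in a
  cyclic order, such that vertices of one part have the same out-neighbors outside it, and an
  out-neighbor of a part is also an out-neighbor of all parts met on the way to it in the cyclic
  order. The parts are colored by induction; a monochromatic cycle that visits several parts would
  have to go around the cyclic order, and giving the entrances of the parts the right colors
  prevents this (\<open>acyclic_split_strong\<close>).
\<close>

section \<open>Acyclic relations\<close>

text \<open>
  Cyclic arcs can be excluded blockwise: an arc that leaves its block for one of larger rank can
  never be completed to a cycle.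
\<close>

lemma acyclic_if_ranked_blocks:
  fixes f :: "'a \<Rightarrow> 'b" and h :: "'b \<Rightarrow> nat"
  assumes arcs: "\<And>u w. (u, w) \<in> r \<Longrightarrow> f u = f w \<or> h (f u) < h (f w)"
    and blocks: "\<And>j. acyclic (Restr r {u. f u = j})"
  shows "acyclic r"
proof -
  have step: "h (f x) < h (f y) \<or> f x = f y \<and> (x, y) \<in> (Restr r {u. f u = f x})\<^sup>+"
    if "(x, y) \<in> r\<^sup>+" for x y
    using that
  proof (induction rule: trancl_induct)
    case (base y)
    then show ?case using arcs[OF base] by auto
  next
    case (step y z)
    show ?case
    proof (cases "h (f x) < h (f z)")
      case False
      with step.IH arcs[OF step.hyps(2)] have "f x = f y" "f y = f z"
        and xy: "(x, y) \<in> (Restr r {u. f u = f x})\<^sup>+"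
        by auto
      moreover from this step.hyps(2) have "(y, z) \<in> Restr r {u. f u = f x}" by auto
      ultimately show ?thesis by (metis trancl_into_trancl)
    qed simp
  qed
  show ?thesis
    unfolding acyclic_def using step blocks unfolding acyclic_def by blast
qed

lemma acyclic_Restr_mono:
  assumes "acyclic (Restr r B)" "A \<subseteq> B"
  shows "acyclic (Restr r A)"
  using assms by (blast intro: acyclic_subset)

lemma acyclic_tournament_if_no_triangle:
  assumes "asym r"
    and connected: "\<And>x y. x \<in> A \<Longrightarrow> y \<in> A \<Longrightarrow> x \<noteq> y \<Longrightarrow> (x, y) \<in> r \<or> (y, x) \<in> r"
    and no_triangle: "\<And>a b c. {a, b, c} \<subseteq> A \<Longrightarrow> \<not> ((a, b) \<in> r \<and> (b, c) \<in> r \<and> (c, a) \<in> r)"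
  shows "acyclic (Restr r A)"
proof -
  have "trans (Restr r A)"
  proof (rule transI)
    fix x y z
    assume "(x, y) \<in> Restr r A" "(y, z) \<in> Restr r A"
    moreover from this have "z \<noteq> x" using asymD[OF assms(1)] by auto
    ultimately show "(x, z) \<in> Restr r A"
      using connected[of x z] no_triangle[of x y z] by auto
  qed
  then show ?thesis
    unfolding acyclic_def using asymD[OF assms(1)] by (auto simp: trancl_id)
qed

section \<open>Digraphs whose out-neighborhoods are tournaments\<close>

text \<open>
  A digraph is represented by its arc relation. Asymmetry excludes loops and digons; given that,
  the second assumption says that no induced out-star has two leaves.
\<close>

locale local_out_tournament =
  fixes R :: "'a rel"
  assumes asym_arcs: "asym R"
    and out_connected: "(x, y) \<in> R \<Longrightarrow> (x, z) \<in> R \<Longrightarrow> y \<noteq> z \<Longrightarrow> (y, z) \<in> R \<or> (z, y) \<in> R"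
begin

lemma no_digon: "(x, y) \<in> R \<Longrightarrow> (y, x) \<notin> R"
  using asymD[OF asym_arcs] .

lemma no_loop: "(x, x) \<notin> R"
  using no_digon[of x x] by blast

lemma local_out_tournament_Restr: "local_out_tournament (Restr R A)"
proof
  show "asym (Restr R A)" using no_digon by (intro asymI) auto
  show "(y, z) \<in> Restr R A \<or> (z, y) \<in> Restr R A"
    if "(x, y) \<in> Restr R A" "(x, z) \<in> Restr R A" "y \<noteq> z" for x y z
    using out_connected[of x y z] that by auto
qed

text \<open>
  Strong connectivity is stated by cuts: no set of vertices other than \<open>{}\<close> and \<open>V\<close> is closed under
  out-neighbors in \<open>V\<close>. A failure yields directly the set along which an induction can split \<open>V\<close>.
\<close>

definition strong_on :: "'a set \<Rightarrow> bool" where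
  "strong_on V \<longleftrightarrow> (\<forall>A. A \<subset> V \<longrightarrow> A \<noteq> {} \<longrightarrow> (\<exists>x\<in>A. \<exists>y\<in>V - A. (x, y) \<in> R))"

end

text \<open>
  For a tournament, an acyclic orientation is the same as a transitive one.
\<close>

locale transitive_out_tournament = local_out_tournament +
  assumes out_acyclic: "acyclic (Restr R (R `` {x}))"
begin

lemma out_clique_source:
  assumes "T \<subseteq> R `` {x}" "finite T" "T \<noteq> {}"
  obtains t where "t \<in> T" "\<And>y. y \<in> T \<Longrightarrow> y \<noteq> t \<Longrightarrow> (t, y) \<in> R"
proof -
  have "finite (Restr R T)" using assms(2) by (meson finite_Int finite_SigmaI)
  moreover have "acyclic (Restr R T)" using acyclic_Restr_mono[OF out_acyclic assms(1)] .
  ultimately have "wf (Restr R T)" by (rule finite_acyclic_wf)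
  then obtain t where "t \<in> T" and min: "\<And>y. (y, t) \<in> Restr R T \<Longrightarrow> y \<notin> T"
    using assms(3) by (metis wfE_min ex_in_conv)
  have "(t, y) \<in> R" if "y \<in> T" "y \<noteq> t" for y
  proof -
    have "(t, y) \<in> R \<or> (y, t) \<in> R"
      using that \<open>t \<in> T\<close> assms(1) out_connected[of x t y] by auto
    then show ?thesis using min that \<open>t \<in> T\<close> by auto
  qed
  with \<open>t \<in> T\<close> show ?thesis by (rule that)
qed

section \<open>Strong digraphs are blown-up round digraphs\<close>

text \<open>
  A map \<open>g\<close> describes a partition of the vertices into its fibers. The partition is out-modular
  if all vertices of a part have the same out-neighbors outside this part.
\<close>

definition out_modular :: "'a set \<Rightarrow> ('a \<Rightarrow> 'b) \<Rightarrow> bool" where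
  "out_modular V g \<longleftrightarrow>
     (\<forall>u\<in>V. \<forall>u'\<in>V. \<forall>w\<in>V. g u = g u' \<longrightarrow> (u, w) \<in> R \<longrightarrow> g w \<noteq> g u \<longrightarrow> (u', w) \<in> R)"

lemma out_modularD:
  assumes "out_modular V g" "u \<in> V" "u' \<in> V" "w \<in> V" "g u = g u'" "(u, w) \<in> R" "g w \<noteq> g u"
  shows "(u', w) \<in> R"
  using assms unfolding out_modular_def by blast

text \<open>
  The vertices outside a part that are reached from it form a transitive tournament; the part
  containing its source is the successor. Since the source dominates the rest of this tournament,
  and out-modularity passes this on to the whole successor part, an out-neighbor of a part is
  inherited by its successor unless it lies in it.
\<close>

lemma successor_part:
  assumes "finite V" "strong_on V" "out_modular V g" "i \<in> g ` V" "card (g ` V) \<ge> 2"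
  shows "\<exists>j \<in> g ` V. j \<noteq> i \<and> (\<forall>u\<in>V. \<forall>w\<in>V. \<forall>x\<in>V. g u = i \<longrightarrow> (u, w) \<in> R \<longrightarrow>
           g w \<noteq> i \<longrightarrow> g w \<noteq> j \<longrightarrow> g x = j \<longrightarrow> (x, w) \<in> R)"
proof -
  let ?A = "{u \<in> V. g u = i}"
  have "g ` V \<noteq> {i}" using assms(5) by auto
  then have "?A \<noteq> V" using assms(4) by auto
  then have "?A \<subset> V" "?A \<noteq> {}" using assms(4) by auto
  then obtain x y where "x \<in> ?A" "y \<in> V - ?A" and xy: "(x, y) \<in> R"
    using assms(2) unfolding strong_on_def by meson
  then have x: "x \<in> V" "g x = i" and y: "y \<in> V" "g y \<noteq> i" by auto
  let ?T = "{w \<in> V. g w \<noteq> i \<and> (x, w) \<in> R}"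
  have "?T \<subseteq> R `` {x}" "finite ?T" "?T \<noteq> {}" using assms(1) y xy by auto
  then obtain t where t: "t \<in> ?T" and source: "\<And>w. w \<in> ?T \<Longrightarrow> w \<noteq> t \<Longrightarrow> (t, w) \<in> R"
    by (rule out_clique_source) (rule that)
  have "(x', w) \<in> R"
    if "u \<in> V" "w \<in> V" "x' \<in> V" "g u = i" "(u, w) \<in> R" "g w \<noteq> i" "g w \<noteq> g t" "g x' = g t"
    for u w x'
  proof -
    have "(x, w) \<in> R" using out_modularD[OF assms(3), of u x w] that x by simp
    then have "(t, w) \<in> R" using that by (intro source) auto
    then show ?thesis using out_modularD[OF assms(3), of t x' w] that t by simp
  qed
  then show ?thesis using t by (intro bexI[of _ "g t"]) auto
qed

text \<open>
  On a cycle of successors \<open>a, S a, S (S a), \<dots>\<close>, an out-neighbor of one part that lies outside all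
  parts of the cycle is passed on all the way round. Hence merging the cycle into one part keeps
  the partition out-modular, and a coarsest nontrivial out-modular partition consists of a single
  cycle.
\<close>

lemma coarsest_is_single_cycle:
  fixes g :: "'a \<Rightarrow> 'b"
  assumes "finite V" and modular: "out_modular V g"
    and coarsest: "\<And>g' :: 'a \<Rightarrow> 'b. out_modular V g' \<Longrightarrow> card (g' ` V) \<ge> 2 \<Longrightarrow>
      card (g ` V) \<le> card (g' ` V)"
    and S_range: "\<And>i. i \<in> g ` V \<Longrightarrow> S i \<in> g ` V"
    and S_neq: "\<And>i. i \<in> g ` V \<Longrightarrow> S i \<noteq> i"
    and inherit: "\<And>u w x. u \<in> V \<Longrightarrow> w \<in> V \<Longrightarrow> x \<in> V \<Longrightarrow> (u, w) \<in> R \<Longrightarrow> g w \<noteq> g u \<Longrightarrow>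
      g w \<noteq> S (g u) \<Longrightarrow> g x = S (g u) \<Longrightarrow> (x, w) \<in> R"
    and a: "a \<in> g ` V" "n > 0" "(S ^^ n) a = a"
  shows "g ` V \<subseteq> range (\<lambda>k. (S ^^ k) a)"
proof (rule ccontr)
  define \<sigma> where "\<sigma> k = (S ^^ k) a" for k
  define M where "M = range \<sigma>"
  define g' where "g' u = (if g u \<in> M then a else g u)" for u
  assume "\<not> g ` V \<subseteq> range (\<lambda>k. (S ^^ k) a)"
  then obtain b where b: "b \<in> V" "g b \<notin> M" unfolding M_def \<sigma>_def by blast
  have \<sigma>_0: "\<sigma> 0 = a" and \<sigma>_Suc: "\<sigma> (Suc k) = S (\<sigma> k)" for k
    by (simp_all add: \<sigma>_def)
  have \<sigma>_M: "\<sigma> k \<in> M" for k unfolding M_def by blast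
  have aM: "a \<in> M" using \<sigma>_M[of 0] \<sigma>_0 by simp
  have in_range: "\<sigma> k \<in> g ` V" for k
    by (induction k) (use a(1) S_range in \<open>auto simp: \<sigma>_0 \<sigma>_Suc\<close>)
  have "(S ^^ (n * q)) a = a" for q
    by (induction q) (simp_all add: funpow_add a(3))
  then have period: "\<sigma> (k + n * q) = \<sigma> k" for k q
    by (simp add: funpow_add \<sigma>_def)
  have pass_on: "(x, w) \<in> R"
    if "u \<in> V" "w \<in> V" "(u, w) \<in> R" "g u = \<sigma> k" "g w \<notin> M" "x \<in> V" "g x = \<sigma> (k + q)"
    for u w x k q
    using that(6,7)
  proof (induction q arbitrary: x)
    case 0
    have "g w \<noteq> g u" using that(4,5) \<sigma>_M by metis
    then show ?case using out_modularD[OF modular, of u x w] that 0 by simp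
  next
    case (Suc q)
    obtain x' where x': "x' \<in> V" "g x' = \<sigma> (k + q)" using in_range[of "k + q"] by auto
    have "(x', w) \<in> R" using Suc.IH x' by blast
    moreover have "g x = S (g x')" using Suc.prems x' by (simp add: \<sigma>_Suc)
    moreover have "g w \<noteq> g x'" "g w \<noteq> g x" using that(5) x'(2) Suc.prems(2) \<sigma>_M by metis+
    ultimately show ?case using inherit[of x' w x] that(2) x'(1) Suc.prems(1) by simp
  qed
  have "out_modular V g'"
    unfolding out_modular_def
  proof (intro ballI impI)
    fix u u' w
    assume uw: "u \<in> V" "u' \<in> V" "w \<in> V" "g' u = g' u'" "(u, w) \<in> R" "g' w \<noteq> g' u"
    show "(u', w) \<in> R"
    proof (cases "g u \<in> M")
      case True
      then have "g u' \<in> M" using uw(4) aM unfolding g'_def by (cases "g u' \<in> M") auto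
      have "g w \<notin> M" using True uw(6) unfolding g'_def by auto
      obtain k l where k: "g u = \<sigma> k" and l: "g u' = \<sigma> l"
        using True \<open>g u' \<in> M\<close> unfolding M_def by blast
      have "k \<le> l + n * k" using a(2) by (simp add: trans_le_add2)
      then obtain q where "l + n * k = k + q" using le_Suc_ex by blast
      then have "g u' = \<sigma> (k + q)" using l period[of l k] by simp
      then show ?thesis using pass_on[OF uw(1,3,5) k \<open>g w \<notin> M\<close> uw(2)] by simp
    next
      case False
      then have "g u' = g u" using uw(4) aM unfolding g'_def by (cases "g u' \<in> M") auto
      moreover have "g w \<noteq> g u" using False uw(6) unfolding g'_def by auto
      ultimately show ?thesis using out_modularD[OF modular, of u u' w] uw by simp
    qed
  qed
  moreover have "card (g' ` V) \<ge> 2"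
  proof -
    obtain v where "v \<in> V" "g v = a" using a(1) by auto
    then have "g' v = a" "g' b = g b" using aM b(2) by (simp_all add: g'_def)
    then have "{a, g b} \<subseteq> g' ` V" using \<open>v \<in> V\<close> b(1) by (auto simp: image_iff intro: bexI[of _ v] bexI[of _ b])
    then have "card {a, g b} \<le> card (g' ` V)" using assms(1) by (intro card_mono) auto
    moreover have "a \<noteq> g b" using aM b by blast
    ultimately show ?thesis by simp
  qed
  moreover have "card (g' ` V) < card (g ` V)"
  proof (rule psubset_card_mono)
    have "S a \<in> M" using \<sigma>_M[of 1] \<sigma>_0 \<sigma>_Suc[of 0] by simp
    then have "S a \<notin> g' ` V" using S_neq[OF a(1)] unfolding g'_def by auto
    moreover have "g' ` V \<subseteq> g ` V" using a(1) unfolding g'_def by auto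
    ultimately show "g' ` V \<subset> g ` V" using S_range[OF a(1)] by blast
  qed (use assms(1) in simp)
  ultimately show False using coarsest[of g'] by simp
qed

text \<open>
  Numbering the parts along that cycle gives the structure theorem: a strong digraph arises from
  a round digraph on \<open>{..<m}\<close> by replacing vertices by out-modules. The last property is
  roundness: going forward along the cycle, out-neighbors are kept until they are reached.
\<close>

lemma round_partition:
  assumes "finite V" "strong_on V" "v \<in> V" "V \<noteq> {v}"
  obtains f :: "'a \<Rightarrow> nat" and m where "f v = 0" "f ` V = {..<m}" "m \<ge> 2" "out_modular V f"
    "\<And>u w x. u \<in> V \<Longrightarrow> w \<in> V \<Longrightarrow> x \<in> V \<Longrightarrow> (u, w) \<in> R \<Longrightarrow> f w \<noteq> f u \<Longrightarrow>
       f x = Suc (f u) mod m \<Longrightarrow> f w \<noteq> f x \<Longrightarrow> (x, w) \<in> R"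
proof -
  let ?P = "\<lambda>g :: 'a \<Rightarrow> 'a. out_modular V g \<and> card (g ` V) \<ge> 2"
  have "?P id"
  proof
    obtain w where "w \<in> V" "w \<noteq> v" using assms(3,4) by blast
    then have "card {v, w} \<le> card V" using assms(1,3) by (intro card_mono) auto
    then show "2 \<le> card (id ` V)" using \<open>w \<noteq> v\<close> by simp
  qed (simp add: out_modular_def)
  then have "\<exists>g. ?P g \<and> (\<forall>g'. ?P g' \<longrightarrow> card (g ` V) \<le> card (g' ` V))"
    by (rule ex_has_least_nat[where P = ?P and k = id and m = "\<lambda>g. card (g ` V)"])
  then obtain g where g: "?P g \<and> (\<forall>g'. ?P g' \<longrightarrow> card (g ` V) \<le> card (g' ` V))"
    by (rule exE)
  then have modular: "out_modular V g" and two: "card (g ` V) \<ge> 2"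
    and coarsest: "\<forall>g'. ?P g' \<longrightarrow> card (g ` V) \<le> card (g' ` V)"
    by simp_all
  have "\<forall>i \<in> g ` V. \<exists>j. j \<in> g ` V \<and> j \<noteq> i \<and> (\<forall>u\<in>V. \<forall>w\<in>V. \<forall>x\<in>V. g u = i \<longrightarrow>
      (u, w) \<in> R \<longrightarrow> g w \<noteq> i \<longrightarrow> g w \<noteq> j \<longrightarrow> g x = j \<longrightarrow> (x, w) \<in> R)"
    using successor_part[OF assms(1,2) modular _ two] by blast
  from bchoice[OF this] obtain S where S_all: "\<forall>i \<in> g ` V. S i \<in> g ` V \<and> S i \<noteq> i \<and> (\<forall>u\<in>V. \<forall>w\<in>V. \<forall>x\<in>V.
      g u = i \<longrightarrow> (u, w) \<in> R \<longrightarrow> g w \<noteq> i \<longrightarrow> g w \<noteq> S i \<longrightarrow> g x = S i \<longrightarrow> (x, w) \<in> R)"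
    by (rule exE)
  then have S: "\<And>i. i \<in> g ` V \<Longrightarrow> S i \<in> g ` V" "\<And>i. i \<in> g ` V \<Longrightarrow> S i \<noteq> i"
    by blast+
  have inherit: "(x, w) \<in> R"
    if "u \<in> V" "w \<in> V" "x \<in> V" "(u, w) \<in> R" "g w \<noteq> g u" "g w \<noteq> S (g u)" "g x = S (g u)"
    for u w x
  proof -
    have "\<forall>u'\<in>V. \<forall>w\<in>V. \<forall>x\<in>V. g u' = g u \<longrightarrow> (u', w) \<in> R \<longrightarrow> g w \<noteq> g u \<longrightarrow> g w \<noteq> S (g u) \<longrightarrow>
        g x = S (g u) \<longrightarrow> (x, w) \<in> R"
      using bspec[OF S_all imageI[OF that(1)]] by (elim conjE)
    from this[rule_format, OF that(1-3) refl that(4-7)] show ?thesis .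
  qed
  have cycle: "g ` V \<subseteq> range (\<lambda>k. (S ^^ k) a)"
    if "a \<in> g ` V" "n > 0" "(S ^^ n) a = a" for a n
  proof (rule coarsest_is_single_cycle[OF assms(1) modular])
    show "card (g ` V) \<le> card (g' ` V)" if "out_modular V g'" "card (g' ` V) \<ge> 2" for g' :: "'a \<Rightarrow> 'a"
      using coarsest that by blast
  qed (use S inherit that in blast)+
  have in_range: "(S ^^ k) (g v) \<in> g ` V" for k
    by (induction k) (use assms(3) S in auto)
  \<comment> \<open>Some iterate of the part of \<open>v\<close> is periodic. Its cycle covers all parts, so the part of
      \<open>v\<close> is periodic itself.\<close>
  have "\<not> inj (\<lambda>k. (S ^^ k) (g v))"
  proof
    assume "inj (\<lambda>k. (S ^^ k) (g v))"
    moreover have "finite (range (\<lambda>k. (S ^^ k) (g v)))"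
      by (rule finite_subset[of _ "g ` V"]) (use in_range assms(1) in auto)
    ultimately show False using finite_imageD by blast
  qed
  then obtain k l where "k < l" and kl: "(S ^^ k) (g v) = (S ^^ l) (g v)"
    unfolding inj_def by (metis linorder_neqE_nat)
  define a where "a = (S ^^ k) (g v)"
  define n where "n = l - k"
  have "n > 0" using \<open>k < l\<close> by (simp add: n_def)
  have "(S ^^ n) a = (S ^^ (n + k)) (g v)" by (simp add: a_def funpow_add)
  also have "\<dots> = a" using \<open>k < l\<close> kl by (simp add: a_def n_def)
  finally have n: "n > 0" "(S ^^ n) a = a" using \<open>n > 0\<close> by simp_all
  have "g v \<in> range (\<lambda>k. (S ^^ k) a)"
    using cycle[OF _ n] in_range[of k] assms(3) a_def by blast
  then obtain k0 where k0: "g v = (S ^^ k0) a" by blast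
  have "(S ^^ n) (g v) = g v"
    using n(2) unfolding k0 by (metis funpow_add add.commute comp_apply)
  then have "\<exists>n. n > 0 \<and> (S ^^ n) (g v) = g v" using n(1) by blast
  define m where "m = (LEAST n. n > 0 \<and> (S ^^ n) (g v) = g v)"
  have m: "m > 0" "(S ^^ m) (g v) = g v"
    using LeastI_ex[OF \<open>\<exists>n. n > 0 \<and> (S ^^ n) (g v) = g v\<close>] unfolding m_def by auto
  have m_least: "\<not> (0 < n \<and> n < m \<and> (S ^^ n) (g v) = g v)" for n
    using not_less_Least[of n "\<lambda>n. n > 0 \<and> (S ^^ n) (g v) = g v"] unfolding m_def by auto
  define f where "f u = (LEAST k. (S ^^ k) (g v) = g u)" for u
  have f: "(S ^^ f u) (g v) = g u" if u: "u \<in> V" for u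
  proof -
    have "g u \<in> range (\<lambda>k. (S ^^ k) (g v))"
      using subsetD[OF cycle[OF imageI[OF assms(3)] m] imageI[OF u, of g]] .
    then obtain k where "g u = (S ^^ k) (g v)" by blast
    then show ?thesis
      unfolding f_def using LeastI[of "\<lambda>k. (S ^^ k) (g v) = g u" k] by metis
  qed
  have inj: "k = l" if "k < m" "l < m" "(S ^^ k) (g v) = (S ^^ l) (g v)" for k l
  proof -
    have less: False if "k < l" "l < m" "(S ^^ k) (g v) = (S ^^ l) (g v)" for k l
    proof -
      have "(S ^^ (m - l + k)) (g v) = (S ^^ (m - l + l)) (g v)"
        using that(3) by (simp only: funpow_add comp_apply)
      then have "(S ^^ (m - l + k)) (g v) = g v" using m(2) that(2) by simp
      then show False using m_least[of "m - l + k"] that by simp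
    qed
    show ?thesis using less[of k l] less[of l k] that by (metis linorder_neqE_nat)
  qed
  have mod_m: "(S ^^ (k mod m)) (g v) = (S ^^ k) (g v)" for k
    using funpow_mod_eq[OF m(2)] .
  have f_less: "f u < m" if "u \<in> V" for u
  proof -
    have "f u \<le> f u mod m"
      using f[OF that] mod_m[of "f u"] unfolding f_def[of u] by (intro Least_le) simp
    then show ?thesis using m(1) by (meson le_less_trans mod_less_divisor)
  qed
  have f_eq: "f u = f w \<longleftrightarrow> g u = g w" if "u \<in> V" "w \<in> V" for u w
  proof
    show "g u = g w" if "f u = f w" using f[OF \<open>u \<in> V\<close>] f[OF \<open>w \<in> V\<close>] that by simp
  qed (simp add: f_def)
  have "f v = 0" unfolding f_def by simp
  moreover have "f ` V = {..<m}"
  proof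
    show "{..<m} \<subseteq> f ` V"
    proof
      fix k assume "k \<in> {..<m}"
      obtain u where "u \<in> V" "g u = (S ^^ k) (g v)" using in_range[of k] by auto
      then have "k = f u" using inj[of k "f u"] f[of u] f_less[of u] \<open>k \<in> {..<m}\<close> by simp
      then show "k \<in> f ` V" using \<open>u \<in> V\<close> by blast
    qed
  qed (use f_less in auto)
  moreover have "m \<ge> 2"
  proof (rule ccontr)
    assume "\<not> m \<ge> 2"
    then have "m = 1" using m(1) by simp
    then show False using m(2) S(2)[of "g v"] assms(3) by simp
  qed
  moreover have "out_modular V f"
    unfolding out_modular_def
  proof (intro ballI impI)
    fix u u' w
    assume "u \<in> V" "u' \<in> V" "w \<in> V" "f u = f u'" "(u, w) \<in> R" "f w \<noteq> f u"
    then show "(u', w) \<in> R" using out_modularD[OF modular, of u u' w] f_eq by simp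
  qed
  moreover have "(x, w) \<in> R"
    if "u \<in> V" "w \<in> V" "x \<in> V" "(u, w) \<in> R" "f w \<noteq> f u" "f x = Suc (f u) mod m" "f w \<noteq> f x"
    for u w x
  proof -
    have "g x = S (g u)"
      using f[OF that(3)] f[OF that(1)] mod_m[of "Suc (f u)"] that(6) by simp
    moreover have "g w \<noteq> g x" "g w \<noteq> g u" using f_eq[OF that(2,3)] f_eq[OF that(2,1)] that(5,7) by simp_all
    ultimately show ?thesis using inherit[of u w x] that by simp
  qed
  ultimately show ?thesis by (rule that)
qed

section \<open>Two colors suffice if the out-neighborhoods are transitive\<close>

text \<open>
  An acyclic coloring of \<open>V\<close> with two colors, given by the class \<open>S\<close> of the first color, in which
  \<open>X\<close> is monochromatic.
\<close>

definition acyclic_split :: "'a set \<Rightarrow> 'a set \<Rightarrow> bool" where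
  "acyclic_split V X \<longleftrightarrow>
     (\<exists>S. X \<subseteq> S \<and> S \<subseteq> V \<and> acyclic (Restr R S) \<and> acyclic (Restr R (V - S)))"

lemma acyclic_split_mono:
  assumes "acyclic_split V Y" "X \<subseteq> Y"
  shows "acyclic_split V X"
proof -
  obtain S where "Y \<subseteq> S" "S \<subseteq> V" "acyclic (Restr R S)" "acyclic (Restr R (V - S))"
    using assms(1) unfolding acyclic_split_def by (elim exE conjE) (rule that)
  then show ?thesis
    unfolding acyclic_split_def using assms(2) by (intro exI[of _ S] conjI) simp_all
qed

text \<open>
  The closed out-neighborhood of the source of a clique of out-neighbors contains this clique.
  Therefore it makes no difference whether the vertex whose out-neighborhood is to be
  monochromatic belongs to the colored set, and this is what carries the induction.
\<close>

lemma acyclic_split_out_neighbors: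
  assumes "finite U" and "\<And>x. x \<in> U \<Longrightarrow> acyclic_split U (U \<inter> insert x (R `` {x}))"
  shows "acyclic_split U (U \<inter> R `` {x})"
proof (cases "U \<inter> R `` {x} = {}")
  case True
  show ?thesis
  proof (cases "U = {}")
    case False
    then obtain y where "y \<in> U" by blast
    from acyclic_split_mono[OF assms(2)[OF this]] show ?thesis using True by simp
  qed (simp add: acyclic_split_def acyclic_def)
next
  case False
  have "U \<inter> R `` {x} \<subseteq> R `` {x}" "finite (U \<inter> R `` {x})" using assms(1) by auto
  then obtain t where t: "t \<in> U \<inter> R `` {x}"
    and "\<And>y. y \<in> U \<inter> R `` {x} \<Longrightarrow> y \<noteq> t \<Longrightarrow> (t, y) \<in> R"
    using False by (rule out_clique_source) (rule that)
  then have "U \<inter> R `` {x} \<subseteq> U \<inter> insert t (R `` {t})" by auto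
  moreover have "acyclic_split U (U \<inter> insert t (R `` {t}))" using t assms(2) by simp
  ultimately show ?thesis by (rule acyclic_split_mono[rotated])
qed

text \<open>
  In a strong digraph take a round partition with parts \<open>0, \<dots>, m - 1\<close> and \<open>v\<close> in part \<open>0\<close>. All
  arcs entering a part end in the out-neighborhood of one vertex of the preceding part, so by
  induction the entrances of a part can be given any one color. Let \<open>r\<close> be the last part with an
  out-neighbor of \<open>v\<close>; the entrances of the parts \<open>1, \<dots>, r\<close> are red, those of later parts are blue.
  Red arcs between parts then end in the parts \<open>0, \<dots>, r\<close>, and by roundness none of these arcs
  goes backwards inside this interval. Blue arcs between parts end in part \<open>0\<close> or after part \<open>r\<close>;
  by the choice of \<open>r\<close> none of them leaps over the parts \<open>1, \<dots>, r\<close>. Both colors therefore have a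
  linear order of the parts that is respected by their arcs.
\<close>

lemma acyclic_split_strong:
  assumes "finite V" "v \<in> V" "V \<noteq> {v}" "strong_on V"
    and IH: "\<And>U x. U \<subset> V \<Longrightarrow> x \<in> U \<Longrightarrow> acyclic_split U (U \<inter> insert x (R `` {x}))"
  shows "acyclic_split V (V \<inter> insert v (R `` {v}))"
proof -
  obtain f :: "'a \<Rightarrow> nat" and m where f_v: "f v = 0" and f_range: "f ` V = {..<m}" and m: "m \<ge> 2"
    and modular: "out_modular V f"
    and forward: "\<And>u w x. u \<in> V \<Longrightarrow> w \<in> V \<Longrightarrow> x \<in> V \<Longrightarrow> (u, w) \<in> R \<Longrightarrow> f w \<noteq> f u \<Longrightarrow>
       f x = Suc (f u) mod m \<Longrightarrow> f w \<noteq> f x \<Longrightarrow> (x, w) \<in> R"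
    using assms(1,4,2,3) by (rule round_partition) (rule that)
  have f_less: "f u < m" if "u \<in> V" for u using f_range that by blast
  have inhabited: "\<exists>u\<in>V. f u = j" if "j < m" for j using f_range that by (metis imageE lessThan_iff)

  have between: "(x, w) \<in> R"
    if "u \<in> V" "w \<in> V" "x \<in> V" "(u, w) \<in> R" "f u < f w" "f u \<le> f x" "f x < f w" for u w x
  proof -
    have "(x, w) \<in> R" if "x \<in> V" "f x = f u + n" "f x < f w" for n x
      using that
    proof (induction n arbitrary: x)
      case 0
      then show ?case
        using out_modularD[OF modular, of u x w] \<open>u \<in> V\<close> \<open>w \<in> V\<close> \<open>(u, w) \<in> R\<close> \<open>f u < f w\<close> by simp
    next
      case (Suc n)
      obtain y where y: "y \<in> V" "f y = f u + n"
        using inhabited[of "f u + n"] Suc.prems f_less[OF \<open>x \<in> V\<close>] by auto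
      then have "(y, w) \<in> R" using Suc by simp
      then show ?case
        using forward[of y w x] y Suc.prems \<open>w \<in> V\<close> f_less[OF \<open>x \<in> V\<close>] by simp
    qed
    then show ?thesis using that by (metis le_add_diff_inverse)
  qed
  have wrap_upper: "(x, w) \<in> R"
    if "u \<in> V" "w \<in> V" "x \<in> V" "(u, w) \<in> R" "f w < f u" "f u \<le> f x" for u w x
  proof -
    have "(x, w) \<in> R" if "x \<in> V" "f x = f u + n" for n x
      using that
    proof (induction n arbitrary: x)
      case 0
      then show ?case
        using out_modularD[OF modular, of u x w] \<open>u \<in> V\<close> \<open>w \<in> V\<close> \<open>(u, w) \<in> R\<close> \<open>f w < f u\<close> by simp
    next
      case (Suc n)
      obtain y where y: "y \<in> V" "f y = f u + n"
        using inhabited[of "f u + n"] Suc.prems f_less[OF \<open>x \<in> V\<close>] by auto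
      then have "(y, w) \<in> R" using Suc by simp
      then show ?case
        using forward[of y w x] y Suc.prems \<open>w \<in> V\<close> \<open>f w < f u\<close> f_less[OF \<open>x \<in> V\<close>] by simp
    qed
    then show ?thesis using that by (metis le_add_diff_inverse)
  qed
  have wrap_lower: "(x, w) \<in> R"
    if "u \<in> V" "w \<in> V" "x \<in> V" "(u, w) \<in> R" "f w < f u" "f x < f w" for u w x
  proof -
    obtain y where y: "y \<in> V" "f y = m - 1" using inhabited[of "m - 1"] m by auto
    then have "f u \<le> f y" using f_less[OF \<open>u \<in> V\<close>] by simp
    then have "(y, w) \<in> R" using wrap_upper[of u w y] that y by simp
    then have "(v, w) \<in> R"
      using forward[of y w v] y f_v m that \<open>f u \<le> f y\<close> assms(2) by simp
    then show ?thesis using between[of v w x] that f_v assms(2) by simp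
  qed

  define r where "r = Max (insert 0 (f ` (V \<inter> R `` {v})))"
  have r_max: "f w \<le> r" if "w \<in> V" "(v, w) \<in> R" for w
    unfolding r_def using that assms(1) by (intro Max_ge) auto
  have r_max_part: "f w \<le> r" if "x \<in> V" "f x = 0" "w \<in> V" "(x, w) \<in> R" for x w
  proof (cases "f w = 0")
    case False
    then show ?thesis
      using out_modularD[OF modular, of x v w] that f_v assms(2) r_max[of w] by simp
  qed simp
  \<comment> \<open>An arc from \<open>u\<close> back to \<open>w\<close> within the parts \<open>0, \<dots>, r\<close> would give a
      digon: an out-neighbor \<open>y\<close> of \<open>v\<close> in part \<open>r\<close> sends an arc to \<open>w\<close> because \<open>u\<close> does, and
      \<open>w\<close> sends an arc to \<open>y\<close> because \<open>v\<close> does.\<close>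
  have no_back_arc: False if "u \<in> V" "w \<in> V" "(u, w) \<in> R" "f w < f u" "f u \<le> r" for u w
  proof -
    have "r \<noteq> 0" using that by simp
    moreover have "r \<in> insert 0 (f ` (V \<inter> R `` {v}))"
      unfolding r_def using assms(1) by (intro Max_in) auto
    ultimately obtain y where y: "y \<in> V" "(v, y) \<in> R" "f y = r" by auto
    have "(w, y) \<in> R" using between[of v y w] y that f_v assms(2) by simp
    moreover have "(y, w) \<in> R" using wrap_upper[of u w y] that y by simp
    ultimately show False using no_digon by blast
  qed

  let ?D = "\<lambda>j. {u \<in> V. f u = j}"
  let ?entrances = "\<lambda>j. {w \<in> ?D j. \<exists>u\<in>V. f u \<noteq> j \<and> (u, w) \<in> R}"
  have part_proper: "?D j \<subset> V" for j
  proof -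
    obtain u where "u \<in> V" "f u = 1" using inhabited[of 1] m by auto
    then have "v \<notin> ?D j \<or> u \<notin> ?D j" using f_v by auto
    then show ?thesis using assms(2) \<open>u \<in> V\<close> by blast
  qed
  have part_split: "acyclic_split (?D j) (?D j \<inter> R `` {x})" for j x
  proof (rule acyclic_split_out_neighbors)
    show "acyclic_split (?D j) (?D j \<inter> insert x (R `` {x}))" if "x \<in> ?D j" for x
      using IH[OF part_proper that] .
  qed (use assms(1) in simp)
  have entrances: "\<exists>x. ?entrances j \<subseteq> ?D j \<inter> R `` {x}" if j: "0 < j" "j < m" for j
  proof -
    have "j - 1 < m" using j by simp
    then obtain x where x: "x \<in> V" "f x = j - 1" using inhabited by blast
    have "(x, w) \<in> R" if "w \<in> V" "f w = j" "u \<in> V" "f u \<noteq> j" "(u, w) \<in> R" for u w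
      using between[of u w x] wrap_lower[of u w x] x that j by (cases "f u < j") auto
    then show ?thesis by (intro exI[of _ x]) auto
  qed
  have entrance_split: "acyclic_split (?D j) (?entrances j)" if "0 < j" "j < m" for j
  proof -
    from entrances[OF that] obtain x where "?entrances j \<subseteq> ?D j \<inter> R `` {x}" by (rule exE)
    then show ?thesis by (rule acyclic_split_mono[OF part_split])
  qed
  define red_set where "red_set j C \<longleftrightarrow>
      C \<subseteq> ?D j \<and> acyclic (Restr R C) \<and> acyclic (Restr R (?D j - C)) \<and>
      (j = 0 \<longrightarrow> ?D j \<inter> insert v (R `` {v}) \<subseteq> C) \<and>
      (0 < j \<longrightarrow> j \<le> r \<longrightarrow> ?entrances j \<subseteq> C) \<and> (r < j \<longrightarrow> ?entrances j \<inter> C = {})" for j C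
  have "\<exists>C. red_set j C"
    if j: "j < m" for j
  proof (cases "j = 0")
    case True
    have "acyclic_split (?D 0) (?D 0 \<inter> insert v (R `` {v}))"
      using IH[OF part_proper, of v 0] assms(2) f_v by simp
    then obtain C where "?D 0 \<inter> insert v (R `` {v}) \<subseteq> C" "C \<subseteq> ?D 0"
      "acyclic (Restr R C)" "acyclic (Restr R (?D 0 - C))"
      unfolding acyclic_split_def by (elim exE conjE) (rule that)
    then show ?thesis unfolding red_set_def using True by (intro exI[of _ C]) simp
  next
    case False
    then obtain C where C: "?entrances j \<subseteq> C" "C \<subseteq> ?D j"
      "acyclic (Restr R C)" "acyclic (Restr R (?D j - C))"
      using entrance_split[of j] j unfolding acyclic_split_def by auto
    show ?thesis
    proof (cases "j \<le> r")
      case True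
      then show ?thesis unfolding red_set_def using C False by (intro exI[of _ C]) simp
    next
      case gt: False
      have "?D j - (?D j - C) = C" using C(2) by blast
      moreover have "?entrances j \<inter> (?D j - C) = {}" using C(1) by blast
      ultimately show ?thesis unfolding red_set_def using C(3,4) gt False by (intro exI[of _ "?D j - C"]) simp
    qed
  qed
  then have "\<forall>j. \<exists>C. j < m \<longrightarrow> red_set j C" by blast
  from choice[OF this] obtain C where "\<forall>j. j < m \<longrightarrow> red_set j (C j)" by (rule exE)
  then have C: "C j \<subseteq> ?D j" "acyclic (Restr R (C j))" "acyclic (Restr R (?D j - C j))"
    "j = 0 \<Longrightarrow> ?D j \<inter> insert v (R `` {v}) \<subseteq> C j"
    "0 < j \<Longrightarrow> j \<le> r \<Longrightarrow> ?entrances j \<subseteq> C j" "r < j \<Longrightarrow> ?entrances j \<inter> C j = {}"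
    if "j < m" for j
    using that unfolding red_set_def by simp_all
  define S where "S = {u \<in> V. u \<in> C (f u)}"
  have red_part: "w \<in> S" if "u \<in> V" "w \<in> V" "(u, w) \<in> R" "f u \<noteq> f w" "0 < f w" "f w \<le> r" for u w
  proof -
    have "?entrances (f w) \<subseteq> C (f w)" using C(5)[OF f_less[OF \<open>w \<in> V\<close>]] that by simp
    then show ?thesis unfolding S_def using that by auto
  qed
  have blue_part: "w \<notin> S" if "u \<in> V" "w \<in> V" "(u, w) \<in> R" "f u \<noteq> f w" "r < f w" for u w
  proof -
    have "?entrances (f w) \<inter> C (f w) = {}" using C(6)[OF f_less[OF \<open>w \<in> V\<close>]] that by simp
    then show ?thesis unfolding S_def using that by auto
  qed

  have "V \<inter> insert v (R `` {v}) \<subseteq> S"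
  proof
    fix w assume w: "w \<in> V \<inter> insert v (R `` {v})"
    show "w \<in> S"
    proof (cases "f w = 0")
      case True
      have "?D 0 \<inter> insert v (R `` {v}) \<subseteq> C 0" using C(4)[of 0] m by simp
      then show ?thesis unfolding S_def using w True by auto
    next
      case False
      then have "(v, w) \<in> R" "w \<in> V" using w f_v assms(2) by auto
      then show ?thesis using red_part[of v w] r_max[of w] False f_v assms(2) by simp
    qed
  qed
  moreover have "S \<subseteq> V" unfolding S_def by blast
  \<comment> \<open>For red the parts after \<open>r\<close>, which no red arc enters from another part, come first.\<close>
  moreover have "acyclic (Restr R S)"
  proof (rule acyclic_if_ranked_blocks[where f = f and h = "\<lambda>j. if r < j then 0 else Suc j"])
    fix u w
    assume uw: "(u, w) \<in> Restr R S"
    then have "u \<in> V" "w \<in> V" "w \<in> S" "(u, w) \<in> R" unfolding S_def by auto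
    then have "\<not> r < f w" if "f u \<noteq> f w" using blue_part[of u w] that by blast
    moreover have "\<not> f u \<le> r" if "f w < f u"
      using no_back_arc[of u w] that \<open>u \<in> V\<close> \<open>w \<in> V\<close> \<open>(u, w) \<in> R\<close> by blast
    ultimately show "f u = f w \<or> (if r < f u then 0 else Suc (f u)) < (if r < f w then 0 else Suc (f w))"
      by (cases "f u" "f w" rule: linorder_cases) auto
  next
    fix j
    show "acyclic (Restr (Restr R S) {u. f u = j})"
    proof (cases "j < m")
      case True
      then have "acyclic (Restr R (C j))" by (rule C(2))
      moreover have "Restr (Restr R S) {u. f u = j} \<subseteq> Restr R (C j)" unfolding S_def by auto
      ultimately show ?thesis by (rule acyclic_subset)
    next
      case False
      then have "Restr (Restr R S) {u. f u = j} = {}" unfolding S_def using f_less by auto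
      then show ?thesis by (simp only: acyclic_def trancl_empty) simp
    qed
  qed
  \<comment> \<open>For blue part \<open>0\<close> comes last, since no blue arc leaves it for another part.\<close>
  moreover have "acyclic (Restr R (V - S))"
  proof (rule acyclic_if_ranked_blocks[where f = f and h = "\<lambda>j. if j = 0 then m else j"])
    fix u w
    assume uw: "(u, w) \<in> Restr R (V - S)"
    have "f w = 0 \<or> r < f w" if "f u \<noteq> f w" using uw red_part[of u w] that by (cases "f w = 0"; cases "f w \<le> r") auto
    moreover have "f w \<le> r" if "f u = 0" using uw r_max_part[of u w] that by simp
    moreover have "f w \<le> r" if "f w < f u" "0 < f w"
      using uw wrap_lower[of u w v] r_max[of w] that f_v assms(2) by simp
    moreover have "f u < m" using f_less[of u] uw by simp
    ultimately show "f u = f w \<or> (if f u = 0 then m else f u) < (if f w = 0 then m else f w)"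
      by (cases "f u" "f w" rule: linorder_cases) auto
  next
    fix j
    show "acyclic (Restr (Restr R (V - S)) {u. f u = j})"
    proof (cases "j < m")
      case True
      then have "acyclic (Restr R (?D j - C j))" by (rule C(3))
      moreover have "Restr (Restr R (V - S)) {u. f u = j} \<subseteq> Restr R (?D j - C j)"
        unfolding S_def by auto
      ultimately show ?thesis by (rule acyclic_subset)
    next
      case False
      then have "Restr (Restr R (V - S)) {u. f u = j} = {}" using f_less by auto
      then show ?thesis by (simp only: acyclic_def trancl_empty) simp
    qed
  qed
  ultimately show ?thesis unfolding acyclic_split_def by blast
qed

theorem acyclic_split_closed_out_neighborhood:
  assumes "finite V" "v \<in> V"
  shows "acyclic_split V (V \<inter> insert v (R `` {v}))"
  using assms
proof (induction V arbitrary: v rule: finite_psubset_induct)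
  case (psubset V)
  note IH = psubset.IH
  show ?case
  proof (cases "strong_on V")
    case True
    show ?thesis
    proof (cases "V = {v}")
      case True
      then have "Restr R V = {}" using no_loop by auto
      then have "acyclic (Restr R V)" by (simp only: acyclic_def trancl_empty) simp
      then show ?thesis unfolding acyclic_split_def
        by (intro exI[of _ V]) (auto simp: acyclic_def)
    next
      case False
      show ?thesis
        by (rule acyclic_split_strong[OF psubset.hyps psubset.prems False True]) (rule IH)
    qed
  next
    case False
    then obtain A where A: "A \<subset> V" "A \<noteq> {}" and closed: "\<not> (\<exists>x\<in>A. \<exists>y\<in>V - A. (x, y) \<in> R)"
      unfolding strong_on_def by blast
    have split: "acyclic_split U (U \<inter> insert v (R `` {v}))" if "U \<subset> V" for U
    proof (cases "v \<in> U")
      case False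
      have "acyclic_split U (U \<inter> R `` {v})"
      proof (rule acyclic_split_out_neighbors)
        show "finite U" using that psubset.hyps finite_subset by blast
      qed (rule IH[OF that])
      then show ?thesis using False by simp
    qed (rule IH[OF that])
    obtain S where S: "A \<inter> insert v (R `` {v}) \<subseteq> S" "S \<subseteq> A"
      "acyclic (Restr R S)" "acyclic (Restr R (A - S))"
      using split[OF A(1)] unfolding acyclic_split_def by blast
    have "V - A \<subset> V" using A by blast
    then obtain T where T: "(V - A) \<inter> insert v (R `` {v}) \<subseteq> T" "T \<subseteq> V - A"
      "acyclic (Restr R T)" "acyclic (Restr R (V - A - T))"
      using split[of "V - A"] unfolding acyclic_split_def by blast
    have union: "acyclic (Restr R (P \<union> Q))"
      if "P \<subseteq> A" "Q \<subseteq> V - A" "acyclic (Restr R P)" "acyclic (Restr R Q)" for P Q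
    proof (rule acyclic_if_ranked_blocks[where f = "\<lambda>u. u \<in> A" and h = of_bool])
      fix u w
      assume "(u, w) \<in> Restr R (P \<union> Q)"
      then have "u \<in> A \<Longrightarrow> w \<in> A" using closed that(1,2) by blast
      then show "(u \<in> A) = (w \<in> A) \<or> (of_bool (u \<in> A) :: nat) < of_bool (w \<in> A)" by auto
    next
      fix j
      show "acyclic (Restr (Restr R (P \<union> Q)) {u. (u \<in> A) = j})"
      proof (cases j)
        case True
        then show ?thesis using that(2) by (intro acyclic_subset[OF that(3)]) auto
      next
        case False
        then show ?thesis using that(1) by (intro acyclic_subset[OF that(4)]) auto
      qed
    qed
    have "acyclic (Restr R (S \<union> T))" using union[of S T] S T by blast
    moreover have "V - (S \<union> T) = (A - S) \<union> (V - A - T)" using S(2) T(2) A(1) by blast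
    then have "acyclic (Restr R (V - (S \<union> T)))" using union[of "A - S" "V - A - T"] S T by auto
    moreover have "V \<inter> insert v (R `` {v}) \<subseteq> S \<union> T" "S \<union> T \<subseteq> V" using S T A(1) by blast+
    ultimately show ?thesis unfolding acyclic_split_def by (intro exI[of _ "S \<union> T"] conjI)
  qed
qed

end


section \<open>Four colors without induced out-stars and in-wheels\<close>

definition in_wheel_free :: "'a rel \<Rightarrow> bool" where
  "in_wheel_free R \<longleftrightarrow> (\<forall>a b c w. (a, b) \<in> R \<longrightarrow> (b, c) \<in> R \<longrightarrow> (c, a) \<in> R \<longrightarrow>
     (a, w) \<in> R \<longrightarrow> (b, w) \<in> R \<longrightarrow> (c, w) \<notin> R)"

lemma in_wheel_freeD:
  assumes "in_wheel_free R" "(a, b) \<in> R" "(b, c) \<in> R" "(c, a) \<in> R" "(a, w) \<in> R" "(b, w) \<in> R"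
  shows "(c, w) \<notin> R"
  using assms(1)[unfolded in_wheel_free_def, rule_format, OF assms(2-)] .

lemma in_wheel_free_Restr:
  assumes "in_wheel_free R"
  shows "in_wheel_free (Restr R A)"
  unfolding in_wheel_free_def
proof (intro allI impI)
  fix a b c w
  assume "(a, b) \<in> Restr R A" "(b, c) \<in> Restr R A" "(c, a) \<in> Restr R A"
    "(a, w) \<in> Restr R A" "(b, w) \<in> Restr R A"
  then show "(c, w) \<notin> Restr R A" using in_wheel_freeD[OF assms, of a b c w] by simp
qed

context local_out_tournament
begin

text \<open>
  Along a path from \<open>w\<close> to \<open>v\<close>, each vertex sends arcs to \<open>y\<close> and to the next vertex of the path,
  so these two are adjacent; the distance assumption forces the direction towards \<open>y\<close>.
\<close>

lemma in_out_neighborhood_if_far: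
  assumes "(w, v) \<in> R ^^ k" "(w, y) \<in> R" "\<And>j. j \<le> k \<Longrightarrow> (y, v) \<notin> R ^^ j"
  shows "(v, y) \<in> R"
  using assms
proof (induction k arbitrary: w)
  case 0
  then show ?case by simp
next
  case (Suc k)
  obtain w' where w': "(w, w') \<in> R" "(w', v) \<in> R ^^ k"
    using Suc.prems(1) by (rule relpow_Suc_E2) (rule that)
  have "w' \<noteq> y" using Suc.prems(3)[of k] w'(2) by auto
  moreover have "(y, w') \<notin> R"
  proof
    assume "(y, w') \<in> R"
    then have "(y, v) \<in> R ^^ Suc k" using w'(2) by (rule relpow_Suc_I2)
    with Suc.prems(3)[OF order_refl] show False by contradiction
  qed
  ultimately have "(w', y) \<in> R" using out_connected[OF w'(1) Suc.prems(2)] by blast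
  then show ?case
    by (rule Suc.IH[OF w'(2)]) (rule Suc.prems(3), erule le_SucI)
qed

text \<open>
  Let \<open>w\<close> be the next vertex on a shortest path from \<open>u\<close> to \<open>v\<close>, and \<open>y\<close> another out-neighbor of
  \<open>u\<close> that is at least as far from \<open>v\<close> as \<open>u\<close>. The arc between \<open>w\<close> and \<open>y\<close> is directed towards
  \<open>w\<close>: otherwise \<open>y\<close> would be joined to the whole path from \<open>w\<close> to \<open>v\<close>, and being too far from
  \<open>v\<close> to send an arc to it, \<open>y\<close> would be an out-neighbor of \<open>v\<close>. In particular, arcs outside the
  closed out-neighborhood of \<open>v\<close> never increase the distance to \<open>v\<close>. So the distance is
  constant on a directed triangle, all three vertices have \<open>w\<close> as an out-neighbor, and this is an
  in-wheel.
\<close>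

lemma no_triangle_outside_closed_out_neighborhood:
  assumes "in_wheel_free R"
    and reach: "(a, v) \<in> R\<^sup>*" "(b, v) \<in> R\<^sup>*" "(c, v) \<in> R\<^sup>*"
    and outside: "{a, b, c} \<inter> insert v (R `` {v}) = {}"
  shows "\<not> ((a, b) \<in> R \<and> (b, c) \<in> R \<and> (c, a) \<in> R)"
proof
  assume triangle: "(a, b) \<in> R \<and> (b, c) \<in> R \<and> (c, a) \<in> R"
  define d where "d x = (LEAST k. (x, v) \<in> R ^^ k)" for x
  have d: "(x, v) \<in> R ^^ d x" if x: "(x, v) \<in> R\<^sup>*" for x
  proof -
    from rtrancl_imp_relpow[OF x] obtain k where "(x, v) \<in> R ^^ k" by (rule exE)
    then show ?thesis unfolding d_def by (rule LeastI)
  qed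
  have d_le: "d x \<le> k" if "(x, v) \<in> R ^^ k" for x k
    unfolding d_def using that by (rule Least_le)
  have far: "(v, y) \<in> R" if "(w, v) \<in> R ^^ k" "(w, y) \<in> R" "k < d y" for w y k
  proof (rule in_out_neighborhood_if_far[OF that(1,2)], rule notI)
    fix j assume "j \<le> k" "(y, v) \<in> R ^^ j"
    then show False using d_le[of y j] that(3) by simp
  qed
  have "\<not> d a < d b" using far[OF d[OF reach(1)], of b] triangle outside by auto
  moreover have "\<not> d b < d c" using far[OF d[OF reach(2)], of c] triangle outside by auto
  moreover have "\<not> d c < d a" using far[OF d[OF reach(3)], of a] triangle outside by auto
  ultimately have eq: "d b = d a" "d c = d a" by simp_all
  have "d a \<noteq> 0" using d[OF reach(1)] outside by (cases "d a") auto
  then obtain k where k: "d a = Suc k" using not0_implies_Suc by blast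
  have "(a, v) \<in> R ^^ Suc k" using d[OF reach(1)] unfolding k .
  then obtain w where w: "(a, w) \<in> R" "(w, v) \<in> R ^^ k" by (rule relpow_Suc_E2) (rule that)
  have inherit: "(y, w) \<in> R"
    if "(x, w) \<in> R" "(x, y) \<in> R" "d y = Suc k" "y \<notin> R `` {v}" for x y
  proof -
    have "y \<noteq> w" using d_le[OF w(2)] that(3) by auto
    moreover have "(w, y) \<notin> R" using far[OF w(2)] that(3,4) by auto
    ultimately show ?thesis using out_connected[OF that(1,2)] by blast
  qed
  have bw: "(b, w) \<in> R" using inherit[OF w(1)] triangle eq k outside by auto
  have "(c, w) \<in> R" using inherit[OF bw] triangle eq k outside by auto
  then show False using in_wheel_freeD[OF assms(1), of a b c w] triangle w(1) bw by simp
qed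

lemma strong_on_imp_reachable:
  assumes "strong_on V" "v \<in> V" "x \<in> V"
  shows "(x, v) \<in> (Restr R V)\<^sup>*"
proof (rule ccontr)
  let ?A = "{x \<in> V. (x, v) \<notin> (Restr R V)\<^sup>*}"
  assume "(x, v) \<notin> (Restr R V)\<^sup>*"
  then have "?A \<noteq> {}" "?A \<subset> V" using assms(2,3) by auto
  then obtain y z where yz: "y \<in> ?A" "z \<in> V - ?A" "(y, z) \<in> R"
    using assms(1) unfolding strong_on_def by meson
  then have "(y, z) \<in> Restr R V" "(z, v) \<in> (Restr R V)\<^sup>*" by auto
  then have "(y, v) \<in> (Restr R V)\<^sup>*" by (rule converse_rtrancl_into_rtrancl)
  then show False using yz(1) by blast
qed

lemma triangle_free_split:
  assumes "finite U"
    and no_triangle: "\<And>a b c. {a, b, c} \<subseteq> U \<Longrightarrow> \<not> ((a, b) \<in> R \<and> (b, c) \<in> R \<and> (c, a) \<in> R)"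
  shows "\<exists>S\<subseteq>U. acyclic (Restr R S) \<and> acyclic (Restr R (U - S))"
proof (cases "U = {}")
  case True
  then show ?thesis by (simp add: acyclic_def)
next
  case False
  interpret U: local_out_tournament "Restr R U" by (rule local_out_tournament_Restr)
  interpret U: transitive_out_tournament "Restr R U"
  proof
    fix x
    show "acyclic (Restr (Restr R U) (Restr R U `` {x}))"
    proof (rule acyclic_tournament_if_no_triangle[OF U.asym_arcs])
      show "(y, z) \<in> Restr R U \<or> (z, y) \<in> Restr R U"
        if "y \<in> Restr R U `` {x}" "z \<in> Restr R U `` {x}" "y \<noteq> z" for y z
        using that U.out_connected[of x y z] by simp
      show "\<not> ((a, b) \<in> Restr R U \<and> (b, c) \<in> Restr R U \<and> (c, a) \<in> Restr R U)" for a b c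
        using no_triangle[of a b c] by auto
    qed
  qed
  obtain v where "v \<in> U" using False by blast
  from U.acyclic_split_closed_out_neighborhood[OF assms(1) this]
  obtain S where "S \<subseteq> U" "acyclic (Restr (Restr R U) S)" "acyclic (Restr (Restr R U) (U - S))"
    unfolding U.acyclic_split_def by (elim exE conjE) (rule that)
  moreover have "Restr (Restr R U) S = Restr R S" "Restr (Restr R U) (U - S) = Restr R (U - S)"
    using \<open>S \<subseteq> U\<close> by auto
  ultimately show ?thesis by auto
qed

text \<open>
  In a tournament without in-wheels the in-neighborhoods are transitive, so the reverse tournament
  has transitive out-neighborhoods.
\<close>

lemma tournament_split:
  assumes "finite T" "in_wheel_free R"
    and connected: "\<And>x y. x \<in> T \<Longrightarrow> y \<in> T \<Longrightarrow> x \<noteq> y \<Longrightarrow> (x, y) \<in> R \<or> (y, x) \<in> R"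
  shows "\<exists>S\<subseteq>T. acyclic (Restr R S) \<and> acyclic (Restr R (T - S))"
proof (cases "T = {}")
  case True
  then show ?thesis by (simp add: acyclic_def)
next
  case False
  let ?Q = "(Restr R T)\<inverse>"
  interpret Q: local_out_tournament ?Q
  proof
    show "asym ?Q" using no_digon by (intro asymI) auto
    show "(y, z) \<in> ?Q \<or> (z, y) \<in> ?Q" if "(x, y) \<in> ?Q" "(x, z) \<in> ?Q" "y \<noteq> z" for x y z
      using that connected[of y z] by auto
  qed
  interpret Q: transitive_out_tournament ?Q
  proof
    fix x
    show "acyclic (Restr ?Q (?Q `` {x}))"
    proof (rule acyclic_tournament_if_no_triangle[OF Q.asym_arcs])
      show "(y, z) \<in> ?Q \<or> (z, y) \<in> ?Q" if "y \<in> ?Q `` {x}" "z \<in> ?Q `` {x}" "y \<noteq> z" for y z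
        using that connected[of y z] by auto
      show "\<not> ((a, b) \<in> ?Q \<and> (b, c) \<in> ?Q \<and> (c, a) \<in> ?Q)" if "{a, b, c} \<subseteq> ?Q `` {x}" for a b c
      proof
        assume "(a, b) \<in> ?Q \<and> (b, c) \<in> ?Q \<and> (c, a) \<in> ?Q"
        then have "(a, c) \<in> R \<and> (c, b) \<in> R \<and> (b, a) \<in> R \<and> (a, x) \<in> R \<and> (c, x) \<in> R \<and> (b, x) \<in> R"
          using that by auto
        then show False using in_wheel_freeD[OF assms(2), of a c b x] by simp
      qed
    qed
  qed
  obtain v where "v \<in> T" using False by blast
  from Q.acyclic_split_closed_out_neighborhood[OF assms(1) this]
  obtain S where "S \<subseteq> T" "acyclic (Restr ?Q S)" "acyclic (Restr ?Q (T - S))"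
    unfolding Q.acyclic_split_def by (elim exE conjE) (rule that)
  moreover have "Restr ?Q S = (Restr R S)\<inverse>" "Restr ?Q (T - S) = (Restr R (T - S))\<inverse>"
    using \<open>S \<subseteq> T\<close> by auto
  ultimately show ?thesis by (auto simp: acyclic_converse)
qed

text \<open>
  Two colors are spent on the closed out-neighborhood of a vertex, a tournament, and two further
  ones on the rest, in which there are no directed triangles.
\<close>

lemma four_coloring_strong:
  assumes "finite V" "in_wheel_free R" "strong_on V" "v \<in> V"
  shows "\<exists>c :: 'a \<Rightarrow> nat. c ` V \<subseteq> {..<4} \<and> (\<forall>i. acyclic (Restr R {u \<in> V. c u = i}))"
proof -
  let ?T = "V \<inter> insert v (R `` {v})"
  have "\<exists>S\<subseteq>?T. acyclic (Restr R S) \<and> acyclic (Restr R (?T - S))"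
  proof (rule tournament_split[OF _ assms(2)])
    show "(x, y) \<in> R \<or> (y, x) \<in> R" if "x \<in> ?T" "y \<in> ?T" "x \<noteq> y" for x y
      using that out_connected[of v x y] by auto
  qed (use assms(1) in simp)
  then obtain S where S: "S \<subseteq> ?T" "acyclic (Restr R S)" "acyclic (Restr R (?T - S))"
    by (elim exE conjE) (rule that)
  interpret V: local_out_tournament "Restr R V" by (rule local_out_tournament_Restr)
  have "\<exists>S\<subseteq>V - ?T. acyclic (Restr R S) \<and> acyclic (Restr R (V - ?T - S))"
  proof (rule triangle_free_split)
    fix a b c
    assume abc: "{a, b, c} \<subseteq> V - ?T"
    have "\<not> ((a, b) \<in> Restr R V \<and> (b, c) \<in> Restr R V \<and> (c, a) \<in> Restr R V)"
      using abc in_wheel_free_Restr[OF assms(2)] strong_on_imp_reachable[OF assms(3) assms(4)]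
      by (intro V.no_triangle_outside_closed_out_neighborhood[of a v b c]) auto
    then show "\<not> ((a, b) \<in> R \<and> (b, c) \<in> R \<and> (c, a) \<in> R)" using abc by auto
  qed (use assms(1) in simp)
  then obtain S' where S': "S' \<subseteq> V - ?T" "acyclic (Restr R S')" "acyclic (Restr R (V - ?T - S'))"
    by (elim exE conjE) (rule that)
  define c :: "'a \<Rightarrow> nat" where
    "c u = (if u \<in> ?T then if u \<in> S then 0 else 1 else if u \<in> S' then 2 else 3)" for u
  have "acyclic (Restr R {u \<in> V. c u = i})" for i
  proof -
    consider "i = 0" | "i = 1" | "i = 2" | "i = 3" | "i > 3" by linarith
    then show ?thesis
    proof cases
      case 1
      then show ?thesis by (intro acyclic_Restr_mono[OF S(2)]) (auto simp: c_def split: if_splits)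
    next
      case 2
      then show ?thesis by (intro acyclic_Restr_mono[OF S(3)]) (auto simp: c_def split: if_splits)
    next
      case 3
      then show ?thesis by (intro acyclic_Restr_mono[OF S'(2)]) (auto simp: c_def split: if_splits)
    next
      case 4
      then show ?thesis by (intro acyclic_Restr_mono[OF S'(3)]) (auto simp: c_def split: if_splits)
    next
      case 5
      then show ?thesis by (intro acyclic_Restr_mono[OF S(2)]) (auto simp: c_def split: if_splits)
    qed
  qed
  moreover have "c ` V \<subseteq> {..<4}" by (auto simp: c_def)
  ultimately show ?thesis by (intro exI[of _ c]) simp
qed

theorem four_coloring:
  assumes "finite V" "in_wheel_free R"
  shows "\<exists>c :: 'a \<Rightarrow> nat. c ` V \<subseteq> {..<4} \<and> (\<forall>i. acyclic (Restr R {u \<in> V. c u = i}))"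
  using assms(1)
proof (induction V rule: finite_psubset_induct)
  case (psubset V)
  consider "V = {}" | v where "v \<in> V" "strong_on V" | "\<not> strong_on V" by blast
  then show ?case
  proof cases
    case 1
    then show ?thesis by (simp add: acyclic_def)
  next
    case 2
    then show ?thesis using four_coloring_strong[OF psubset.hyps assms(2)] by simp
  next
    case 3
    then obtain A where A: "A \<subset> V" "A \<noteq> {}" and closed: "\<not> (\<exists>x\<in>A. \<exists>y\<in>V - A. (x, y) \<in> R)"
      unfolding strong_on_def by blast
    have "V - A \<subset> V" using A by blast
    obtain c :: "'a \<Rightarrow> nat" where c: "c ` A \<subseteq> {..<4}" "\<And>i. acyclic (Restr R {u \<in> A. c u = i})"
      using psubset.IH[OF A(1)] by auto
    obtain c' :: "'a \<Rightarrow> nat" where c': "c' ` (V - A) \<subseteq> {..<4}"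
      "\<And>i. acyclic (Restr R {u \<in> V - A. c' u = i})"
      using psubset.IH[OF \<open>V - A \<subset> V\<close>] by auto
    \<comment> \<open>No arc leaves \<open>A\<close>, so the colorings of \<open>A\<close> and of its complement do not interfere.\<close>
    define e where "e u = (if u \<in> A then c u else c' u)" for u
    have "acyclic (Restr R {u \<in> V. e u = i})" for i
    proof (rule acyclic_if_ranked_blocks[where f = "\<lambda>u. u \<in> A" and h = of_bool])
      fix u w
      assume "(u, w) \<in> Restr R {u \<in> V. e u = i}"
      then have "u \<in> A \<Longrightarrow> w \<in> A" using closed by blast
      then show "(u \<in> A) = (w \<in> A) \<or> (of_bool (u \<in> A) :: nat) < of_bool (w \<in> A)" by auto
    next
      fix j
      show "acyclic (Restr (Restr R {u \<in> V. e u = i}) {u. (u \<in> A) = j})"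
      proof (cases j)
        case True
        then show ?thesis by (intro acyclic_subset[OF c(2)[of i]]) (auto simp: e_def)
      next
        case False
        then show ?thesis by (intro acyclic_subset[OF c'(2)[of i]]) (auto simp: e_def)
      qed
    qed
    moreover have "e ` V \<subseteq> {..<4}" using c(1) c'(1) by (auto simp: e_def)
    ultimately show ?thesis by (intro exI[of _ e]) simp
  qed
qed

end

section \<open>From arc relations to digraphs\<close>

lemma has_induced_if_bij_betw:
  assumes "pair_wf_digraph D" "A \<subseteq> pverts D" "bij_betw \<phi> A (pverts F)"
    and arcs: "\<And>x y. x \<in> A \<Longrightarrow> y \<in> A \<Longrightarrow> (x, y) \<in> parcs D \<longleftrightarrow> (\<phi> x, \<phi> y) \<in> parcs F"
    and F: "parcs F \<subseteq> pverts F \<times> pverts F"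
  shows "has_induced D F"
proof -
  interpret D: pair_wf_digraph D by fact
  let ?H = "with_proj D \<restriction> A"
  let ?iso = "\<lparr>iso_verts = \<phi>, iso_arcs = map_prod \<phi> \<phi>, iso_head = snd, iso_tail = fst\<rparr>"
  have H: "induced_subgraph ?H (with_proj D)"
    using assms(2) by (intro D.induced_induce) simp
  have "wf_digraph ?H" by (rule D.wellformed_induce_subgraph)
  moreover have inj: "inj_on \<phi> A" using assms(3) by (rule bij_betw_imp_inj_on)
  moreover have "inj_on (map_prod \<phi> \<phi>) (arcs ?H)"
    by (rule inj_on_subset[OF map_prod_inj_on[OF inj inj]]) auto
  ultimately have "pre_digraph.digraph_isomorphism ?H ?iso"
    unfolding pre_digraph.digraph_isomorphism_def by auto
  moreover have image: "\<phi> ` A = pverts F" using assms(3) by (rule bij_betw_imp_surj_on)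
  have "map_prod \<phi> \<phi> ` arcs ?H = parcs F"
  proof (intro equalityI subsetI)
    fix e assume "e \<in> parcs F"
    then obtain i j where e: "e = (i, j)" "i \<in> \<phi> ` A" "j \<in> \<phi> ` A" using F image by (cases e) auto
    then obtain x y where "x \<in> A" "y \<in> A" "i = \<phi> x" "j = \<phi> y" by blast
    then show "e \<in> map_prod \<phi> \<phi> ` arcs ?H"
      using arcs \<open>e \<in> parcs F\<close> e(1) by (auto intro!: image_eqI[of _ _ "(x, y)"])
  qed (use arcs in auto)
  with image have "with_proj F = app_iso ?iso ?H"
    by (simp add: app_iso_def with_proj_def)
  ultimately show ?thesis
    unfolding has_induced_def digraph_iso_def using H by blast
qed

lemma acyclic_digraph_if_acyclic:
  assumes "pair_wf_digraph D" "acyclic (Restr (parcs D) A)"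
  shows "acyclic_digraph (with_proj D \<restriction> A)"
proof -
  interpret D: pair_wf_digraph D by fact
  let ?H = "with_proj D \<restriction> A"
  interpret H: wf_digraph ?H by (rule D.wellformed_induce_subgraph)
  have "arcs_ends ?H = Restr (parcs D) A"
    by (auto simp: arcs_ends_def arc_to_ends_def)
  then have "\<not> (u \<rightarrow>\<^sup>+\<^bsub>?H\<^esub> u)" for u
    using assms(2) unfolding acyclic_def by simp
  then show ?thesis
    unfolding acyclic_digraph_def H.cycle_def using H.reachable1_awalkI by blast
qed

context
  fixes D :: "'a pair_pre_digraph"
  assumes D: "D \<in> Forb_ind {digon, out_star 2, in_wheel3}"
begin

interpretation pair_digraph D
  using D by (simp add: Forb_ind_def)

lemma asym_parcs: "asym (parcs D)"
proof (rule asymI, rule notI)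
  fix x y
  assume arcs: "(x, y) \<in> parcs D" "(y, x) \<in> parcs D"
  then have "x \<noteq> y" "x \<in> pverts D" "y \<in> pverts D"
    using pair_no_loops wellformed' by fastforce+
  have no_loop: "(z, z) \<notin> parcs D" for z using pair_no_loops[of "(z, z)"] by auto
  let ?\<phi> = "\<lambda>z. if z = x then 0 else 1 :: nat"
  have "has_induced D digon"
  proof (rule has_induced_if_bij_betw[where A = "{x, y}" and \<phi> = ?\<phi>])
    show "bij_betw ?\<phi> {x, y} (pverts digon)"
      using \<open>x \<noteq> y\<close> by (auto simp: bij_betw_def digon_def)
    show "(a, b) \<in> parcs D \<longleftrightarrow> (?\<phi> a, ?\<phi> b) \<in> parcs digon" if "a \<in> {x, y}" "b \<in> {x, y}" for a b
      using that arcs \<open>x \<noteq> y\<close> no_loop by (auto simp: digon_def)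
    show "parcs digon \<subseteq> pverts digon \<times> pverts digon" by (auto simp: digon_def)
  qed (use \<open>x \<in> pverts D\<close> \<open>y \<in> pverts D\<close> pair_wf_digraph_axioms in auto)
  then show False using D by (simp add: Forb_ind_def)
qed

lemma local_out_tournament_parcs: "local_out_tournament (parcs D)"
proof
  show "asym (parcs D)" by (rule asym_parcs)
  fix x y z
  assume arcs: "(x, y) \<in> parcs D" "(x, z) \<in> parcs D" and "y \<noteq> z"
  show "(y, z) \<in> parcs D \<or> (z, y) \<in> parcs D"
  proof (rule ccontr)
    assume nonadjacent: "\<not> ((y, z) \<in> parcs D \<or> (z, y) \<in> parcs D)"
    have no_digon: "(b, a) \<notin> parcs D" if "(a, b) \<in> parcs D" for a b
      using asymD[OF asym_parcs that] .
    then have no_loop: "(a, a) \<notin> parcs D" for a by blast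
    then have neq: "x \<noteq> y" "x \<noteq> z" using arcs by blast+
    have out_star_2: "pverts (out_star 2) = {0, 1, 2}" "parcs (out_star 2) = {(0, 1), (0, 2)}"
      by (auto simp: out_star_def)
    let ?\<phi> = "\<lambda>u. if u = x then 0 else if u = y then 1 else 2 :: nat"
    have "has_induced D (out_star 2)"
    proof (rule has_induced_if_bij_betw[where A = "{x, y, z}" and \<phi> = ?\<phi>])
      show "bij_betw ?\<phi> {x, y, z} (pverts (out_star 2))"
        using neq \<open>y \<noteq> z\<close> unfolding out_star_2 by (auto simp: bij_betw_def inj_on_def)
      show "(a, b) \<in> parcs D \<longleftrightarrow> (?\<phi> a, ?\<phi> b) \<in> parcs (out_star 2)"
        if "a \<in> {x, y, z}" "b \<in> {x, y, z}" for a b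
        using that arcs[THEN no_digon] arcs nonadjacent neq \<open>y \<noteq> z\<close> no_loop
        unfolding out_star_2 by auto
      show "parcs (out_star 2) \<subseteq> pverts (out_star 2) \<times> pverts (out_star 2)"
        unfolding out_star_2 by auto
    qed (use arcs wellformed' pair_wf_digraph_axioms in auto)
    then show False using D by (simp add: Forb_ind_def)
  qed
qed

lemma in_wheel_free_parcs: "in_wheel_free (parcs D)"
  unfolding in_wheel_free_def
proof (intro allI impI notI)
  fix a b c w
  assume arcs: "(a, b) \<in> parcs D" "(b, c) \<in> parcs D" "(c, a) \<in> parcs D"
    "(a, w) \<in> parcs D" "(b, w) \<in> parcs D" "(c, w) \<in> parcs D"
  have no_digon: "(y, x) \<notin> parcs D" if "(x, y) \<in> parcs D" for x y
    using asymD[OF asym_parcs that] .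
  then have no_loop: "(x, x) \<notin> parcs D" for x by blast
  have neq: "a \<noteq> b" "b \<noteq> c" "a \<noteq> c" "w \<noteq> a" "w \<noteq> b" "w \<noteq> c" using arcs no_loop by blast+
  have wheel: "pverts in_wheel3 = {0, 1, 2, 3}"
    "parcs in_wheel3 = {(1, 0), (2, 0), (3, 0), (1, 2), (2, 3), (3, 1)}"
    by (auto simp: in_wheel3_def in_star_def)
  let ?\<phi> = "\<lambda>u. if u = w then 0 else if u = a then 1 else if u = b then 2 else 3 :: nat"
  have "has_induced D in_wheel3"
  proof (rule has_induced_if_bij_betw[where A = "{w, a, b, c}" and \<phi> = ?\<phi>])
    show "bij_betw ?\<phi> {w, a, b, c} (pverts in_wheel3)"
      using neq unfolding wheel by (auto simp: bij_betw_def inj_on_def)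
    show "(x, y) \<in> parcs D \<longleftrightarrow> (?\<phi> x, ?\<phi> y) \<in> parcs in_wheel3"
      if "x \<in> {w, a, b, c}" "y \<in> {w, a, b, c}" for x y
      using that arcs arcs[THEN no_digon] neq neq[symmetric] no_loop unfolding wheel by auto
    show "parcs in_wheel3 \<subseteq> pverts in_wheel3 \<times> pverts in_wheel3" unfolding wheel by auto
  qed (use arcs wellformed' pair_wf_digraph_axioms in auto)
  then show False using D by (simp add: Forb_ind_def)
qed

lemma acyclic_colorable_4: "acyclic_colorable 4 D"
proof -
  interpret L: local_out_tournament "parcs D" by (rule local_out_tournament_parcs)
  obtain c :: "'a \<Rightarrow> nat" where c: "c ` pverts D \<subseteq> {..<4}"
    "\<And>i. acyclic (Restr (parcs D) {u \<in> pverts D. c u = i})"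
    using L.four_coloring[OF pair_finite_verts in_wheel_free_parcs] by auto
  have "acyclic_coloring D {..<4} c"
    unfolding acyclic_coloring_def
    using c by (auto intro!: acyclic_digraph_if_acyclic pair_wf_digraph_axioms)
  then show ?thesis
    unfolding acyclic_colorable_def by (intro exI[of _ "{..<4}"] exI[of _ c]) simp
qed

end

text \<open>
  The class is nonempty, as it contains the empty digraph; so its dichromatic number is the
  maximum of a nonempty finite set.
\<close>

theorem theorem3:
  fixes \<C> :: "'a pair_pre_digraph set"
  defines "\<C> \<equiv> Forb_ind {digon, out_star 2, in_wheel3}"
  shows "bdd_above (dichromatic_number ` \<C>) \<and> class_dichromatic_number \<C> \<le> 4"
proof -
  have "dichromatic_number D \<le> 4" if "D \<in> \<C>" for D
    unfolding dichromatic_number_def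
    using acyclic_colorable_4[of D] that unfolding \<C>_def by (intro Least_le)
  then have bound: "dichromatic_number ` \<C> \<subseteq> {..4}" by auto
  let ?E = "\<lparr>pverts = {}, parcs = {}\<rparr> :: 'a pair_pre_digraph"
  have "pair_digraph ?E" by unfold_locales auto
  moreover have "\<not> has_induced ?E F" if "pverts F \<noteq> {}" for F :: "nat pair_pre_digraph"
  proof
    assume "has_induced ?E F"
    then obtain H where "induced_subgraph H (with_proj ?E)" "digraph_iso H (with_proj F)"
      unfolding has_induced_def by blast
    moreover from this have "verts H = {}" by (auto simp: subgraph_def)
    ultimately show False using that unfolding digraph_iso_def
      by (metis image_empty verts_app_iso with_proj_simps(1))
  qed
  ultimately have "?E \<in> \<C>"
    unfolding \<C>_def Forb_ind_def
    by (auto simp: digon_def out_star_def in_wheel3_def in_star_def)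
  then have "Max (dichromatic_number ` \<C>) \<in> dichromatic_number ` \<C>"
    using finite_subset[OF bound] by (intro Max_in) auto
  then show ?thesis
    unfolding class_dichromatic_number_def using bound bdd_above_mono[OF _ bound] by auto
qed

end
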